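(* Let $X$ be a Banach space (not necessarily reflexive), let $u_0\in X$, and let $F:X\to X$ be a three times Fréchet differentiable map such that for every $R>0$ there are finite constants $M_1(R),M_2(R),M_3(R)>0$ with $$\sup_{u\in B(u_0,R)}\|F^{(j)}(u)\|\le M_j(R),\qquad j=1,2,3.$$ Assume that there are constants $c_0>0$, $k>0$ and $\varepsilon_0>0$ such that for every $u\in X$ and every $\varepsilon\in(0,\varepsilon_0)$ the operator $F'(u)+\varepsilon I$ is boundedly invertible and $$\|(F'(u)+\varepsilon I)^{-1}\|\le c_0\,\varepsilon^{-k}.$$ Assume that the equation $F(u)=0$ is solvable and let $y\in X$ satisfy $F(y)=0$. Assume that there is $\psi\in X$ with $$y=F'(y)\psi,$$ and that $$2c_0M_2\|\psi\|\,\varepsilon^{1-k}<1\qquad\text{for all }\varepsilon\in(0,\varepsilon_0),$$ where $M_2:=M_2(R)$ for some fixed $R>0$ such that $y$ lies in the interior of $B(u_0,R)$. Then, for all sufficiently small $\varepsilon\in(0,\varepsilon_0)$, there exists a unique solution $v_\varepsilon$ of the equation $F(v)+\varepsilon v=0$ such that $$\|v_\varepsilon-y\|=O(\varepsilon^k)\qquad\text{as }\varepsilon\to0;$$ that is, there exist $C>0$ and $\varepsilon_1\in(0,\varepsilon_0]$ such that for every $\varepsilon\in(0,\varepsilon_1)$ there is exactly one $v_\varepsilon\in X$ with $F(v_\varepsilon)+\varepsilon v_\varepsilon=0$ and $\|v_\varepsilon-y\|\le C\varepsilon^k$.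
   Context: $B(u_0,R):=\{u\in X:\|u-u_0\|\le R\}$. $F^{(j)}(u)$ is the $j$-th Fréchet derivative of $F$ at $u$, with $F'=F^{(1)}$, and its norm is the usual norm of bounded ($j$-linear) operators. $I$ is the identity operator on $X$. *)

theory Defs
  imports "HOL-Analysis.Analysis"
begin

definition blinfun_inverse_of ::
  "('a::real_normed_vector \<Rightarrow>\<^sub>L 'b::real_normed_vector) \<Rightarrow> ('b \<Rightarrow>\<^sub>L 'a) \<Rightarrow> bool"
  where "blinfun_inverse_of A B \<longleftrightarrow> A o\<^sub>L B = id_blinfun \<and> B o\<^sub>L A = id_blinfun"

definition boundedly_invertible ::
  "('a::real_normed_vector \<Rightarrow>\<^sub>L 'b::real_normed_vector) \<Rightarrow> bool"
  where "boundedly_invertible A \<longleftrightarrow> (\<exists>B. blinfun_inverse_of A B)"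

(* Only meaningful when A is boundedly invertible; otherwise the value is unspecified. *)
definition blinfun_inv ::
  "('a::real_normed_vector \<Rightarrow>\<^sub>L 'b::real_normed_vector) \<Rightarrow> ('b \<Rightarrow>\<^sub>L 'a)"
  where "blinfun_inv A = (THE B. blinfun_inverse_of A B)"

lemma blinfun_inverse_of_unique:
  assumes "blinfun_inverse_of A B" "blinfun_inverse_of A C"
  shows "B = C"
proof (rule blinfun_eqI)
  fix x
  have "blinfun_apply A (blinfun_apply C x) = x"
    using assms(2) unfolding blinfun_inverse_of_def
    by (metis blinfun_apply_blinfun_compose id_blinfun.rep_eq)
  moreover have "blinfun_apply B (blinfun_apply A (blinfun_apply C x)) = blinfun_apply C x"
    using assms(1) unfolding blinfun_inverse_of_def
    by (metis blinfun_apply_blinfun_compose id_blinfun.rep_eq)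
  ultimately show "blinfun_apply B x = blinfun_apply C x" by simp
qed

lemma blinfun_inv_eq:
  assumes "blinfun_inverse_of A B"
  shows "blinfun_inv A = B"
  unfolding blinfun_inv_def
  using assms blinfun_inverse_of_unique by (blast intro: the_equality)

(* F1, F2, F3 are the first three Frechet derivatives of F, everywhere on the space.
   The j-th derivative is curried: 'a => ('a => ... 'a) in place of a bounded j-linear map;
   the nested operator norm equals the usual norm of bounded j-linear maps. *)
definition frechet_derivs3 ::
  "('a::real_normed_vector \<Rightarrow> 'b::real_normed_vector)
    \<Rightarrow> ('a \<Rightarrow> 'a \<Rightarrow>\<^sub>L 'b)
    \<Rightarrow> ('a \<Rightarrow> 'a \<Rightarrow>\<^sub>L 'a \<Rightarrow>\<^sub>L 'b)
    \<Rightarrow> ('a \<Rightarrow> 'a \<Rightarrow>\<^sub>L 'a \<Rightarrow>\<^sub>L 'a \<Rightarrow>\<^sub>L 'b) \<Rightarrow> bool"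
  where "frechet_derivs3 F F1 F2 F3 \<longleftrightarrow>
    (\<forall>u. (F has_derivative blinfun_apply (F1 u)) (at u)) \<and>
    (\<forall>u. (F1 has_derivative blinfun_apply (F2 u)) (at u)) \<and>
    (\<forall>u. (F2 has_derivative blinfun_apply (F3 u)) (at u))"

end

theory Submission
  imports Defs
begin

text \<open>
  Since the inverses of \<open>F'(u) + \<epsilon>I\<close> are bounded by \<open>L = c\<^sub>0 \<epsilon>\<^sup>-\<^sup>k\<close> uniformly in \<open>u\<close>, the map
  \<open>G = F + \<epsilon>I\<close> is a global bijection (Hadamard), and \<open>G v = 0\<close> has a solution within \<open>2L \<parallel>G w\<parallel>\<close>
  of any given \<open>w\<close>. The source condition makes \<open>w = y - \<epsilon>\<psi>\<close> an approximate solution with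
  \<open>\<parallel>G w\<parallel> = O(\<epsilon>\<^sup>2)\<close>, so that \<open>\<parallel>v - y\<parallel> = O(\<epsilon>) + O(\<epsilon>\<^bsup>2-k\<^esup>)\<close>. The smallness assumption
  enters only by forcing \<open>k \<le> 1\<close> or \<open>\<psi> = 0\<close>. A contraction argument on a ball of radius
  \<open>C\<epsilon>\<^sup>k\<close> around \<open>y\<close> would not suffice for \<open>k = 1\<close>.
\<close>

section \<open>Local inversion with explicit radius and constants\<close>

text \<open>The map \<open>z - B (G z)\<close> has derivative \<open>B (G1 x - G1 z)\<close>, of
  norm at most \<open>L * M * r \<le> 1/2\<close> on the ball, so it halves distances there.
  Absorbing half of \<open>a - b\<close> gives the first claim; Banach's fixed point theorem for the
  Newton map with derivative frozen at \<open>x\<close> gives the second.\<close>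

lemma quantitative_local_inverse:
  fixes G :: "'a::banach \<Rightarrow> 'a"
  assumes der: "\<And>u. (G has_derivative blinfun_apply (G1 u)) (at u)"
    and inv: "blinfun_inverse_of (G1 x) B" "norm B \<le> L"
    and L: "L > 0"
    and lip: "\<And>z. z \<in> cball x r \<Longrightarrow> norm (G1 z - G1 x) \<le> M * norm (z - x)"
    and M: "M \<ge> 0" "L * M * r \<le> 1 / 2" and r: "r > 0"
  shows "\<And>a b. a \<in> cball x r \<Longrightarrow> b \<in> cball x r \<Longrightarrow> norm (a - b) \<le> 2 * L * norm (G a - G b)"
    and "\<And>p. norm (p - G x) \<le> r / (2 * L) \<Longrightarrow> \<exists>z \<in> cball x r. G z = p"
proof -
  have GB: "blinfun_apply (G1 x) (blinfun_apply B w) = w"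
    and BG: "blinfun_apply B (blinfun_apply (G1 x) w) = w" for w
    using inv(1) unfolding blinfun_inverse_of_def
    by (metis blinfun_apply_blinfun_compose id_blinfun.rep_eq)+
  have nB: "norm (blinfun_apply B w) \<le> L * norm w" for w
    using norm_blinfun[of B w] mult_right_mono[OF inv(2), of "norm w"] by simp
  have contr: "norm ((a - blinfun_apply B (G a)) - (b - blinfun_apply B (G b))) \<le> 1/2 * norm (a - b)"
    if "a \<in> cball x r" "b \<in> cball x r" for a b
  proof (rule differentiable_bound[OF convex_cball _ _ that])
    fix z assume z: "z \<in> cball x r"
    show "((\<lambda>z. z - blinfun_apply B (G z)) has_derivative
        (\<lambda>w. w - blinfun_apply B (blinfun_apply (G1 z) w))) (at z within cball x r)"
      by (intro derivative_intros bounded_linear.has_derivative[OF blinfun.bounded_linear_right]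
            has_derivative_at_withinI[OF der])
    show "onorm (\<lambda>w. w - blinfun_apply B (blinfun_apply (G1 z) w)) \<le> 1/2"
    proof (rule onorm_bound)
      fix w
      have "norm (G1 z - G1 x) \<le> M * r"
        using lip[OF z] z M(1) mult_left_mono[of "norm (z - x)" r M]
        by (simp add: dist_norm norm_minus_commute)
      then have "norm (blinfun_apply (G1 z - G1 x) w) \<le> M * r * norm w"
        using norm_blinfun[of "G1 z - G1 x" w] mult_right_mono[of "norm (G1 z - G1 x)" "M * r" "norm w"]
        by simp
      then have "norm (blinfun_apply B (blinfun_apply (G1 z - G1 x) w)) \<le> L * (M * r * norm w)"
        using L by (intro order_trans[OF nB] mult_left_mono) auto
      also have "\<dots> \<le> 1/2 * norm w"
        using mult_right_mono[OF M(2), of "norm w"] by (simp add: mult.assoc)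
      also have "blinfun_apply B (blinfun_apply (G1 z - G1 x) w)
          = - (w - blinfun_apply B (blinfun_apply (G1 z) w))"
        by (simp add: blinfun.diff_left blinfun.diff_right BG)
      finally show "norm (w - blinfun_apply B (blinfun_apply (G1 z) w)) \<le> 1/2 * norm w"
        by (simp only: norm_minus_cancel)
    qed simp
  qed
  show "norm (a - b) \<le> 2 * L * norm (G a - G b)" if "a \<in> cball x r" "b \<in> cball x r" for a b
  proof -
    have "norm (a - b) = norm (((a - blinfun_apply B (G a)) - (b - blinfun_apply B (G b)))
        + blinfun_apply B (G a - G b))"
      by (simp add: blinfun.diff_right)
    also have "\<dots> \<le> 1/2 * norm (a - b) + L * norm (G a - G b)"
      by (rule norm_triangle_mono[OF contr[OF that] nB])
    finally show ?thesis by simp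
  qed
  show "\<exists>z \<in> cball x r. G z = p" if p: "norm (p - G x) \<le> r / (2 * L)" for p
  proof -
    \<comment> \<open>\<open>\<Phi>\<close> is the halving map shifted by the constant
      \<open>B p\<close>. Its fixed points solve \<open>G z = p\<close> because \<open>B\<close> is
      injective. The bound on \<open>p\<close> makes the first step from \<open>x\<close> at most
      \<open>r / 2\<close>, which together with the contraction keeps the ball invariant.\<close>
    define \<Phi> where "\<Phi> z = z - blinfun_apply B (G z - p)" for z
    have \<Phi>_contr: "norm (\<Phi> a - \<Phi> b) \<le> 1/2 * norm (a - b)"
      if "a \<in> cball x r" "b \<in> cball x r" for a b
      using contr[OF that] by (simp add: \<Phi>_def blinfun.diff_right algebra_simps)
    have "norm (blinfun_apply B (p - G x)) \<le> r / 2"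
      using nB[of "p - G x"] mult_left_mono[OF p, of L] L by simp
    then have x_step: "norm (\<Phi> x - x) \<le> r / 2"
      by (simp add: \<Phi>_def blinfun.diff_right norm_minus_commute)
    have "\<exists>!z\<in>cball x r. \<Phi> z = z"
    proof (rule Banach_fix[where c = "1/2"])
      show "\<Phi> ` cball x r \<subseteq> cball x r"
      proof (rule image_subsetI)
        fix z assume z: "z \<in> cball x r"
        have "norm (\<Phi> z - x) \<le> norm (\<Phi> z - \<Phi> x) + norm (\<Phi> x - x)"
          using norm_triangle_ineq[of "\<Phi> z - \<Phi> x" "\<Phi> x - x"] by simp
        also have "\<dots> \<le> 1/2 * norm (z - x) + r / 2"
          using \<Phi>_contr[OF z, of x] r x_step by (intro add_mono) auto
        also have "\<dots> \<le> r"
          using z by (simp add: dist_norm norm_minus_commute)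
        finally show "\<Phi> z \<in> cball x r"
          by (simp add: dist_norm norm_minus_commute)
      qed
    qed (use r \<Phi>_contr in \<open>auto simp: complete_eq_closed dist_norm\<close>)
    then obtain z where z: "z \<in> cball x r" "\<Phi> z = z" by blast
    then have "blinfun_apply B (G z - p) = 0" by (simp add: \<Phi>_def)
    then have "G z - p = 0" using GB[of "G z - p"] by simp
    then show ?thesis using z(1) by auto
  qed
qed

section \<open>Global solvability and injectivity by path lifting\<close>

text \<open>Hypotheses of Hadamard's global inversion theorem in quantitative form: one
  \<open>L\<close> serves all \<open>u\<close>, which keeps lifts of bounded segments bounded, while
  the Lipschitz constant of \<open>G1\<close> may grow with the radius.\<close>

locale hadamard =
  fixes G :: "'a::banach \<Rightarrow> 'a" and G1 :: "'a \<Rightarrow> 'a \<Rightarrow>\<^sub>L 'a" and L :: real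
  assumes der: "\<And>u. (G has_derivative blinfun_apply (G1 u)) (at u)"
    and L_pos: "L > 0"
    and inverse: "\<And>u. \<exists>B. blinfun_inverse_of (G1 u) B \<and> norm B \<le> L"
    and locally_lipschitz: "\<And>\<rho>. \<exists>M. \<forall>a \<in> cball 0 \<rho>. \<forall>b \<in> cball 0 \<rho>.
          norm (G1 a - G1 b) \<le> M * norm (a - b)"
begin

text \<open>One \<open>r\<close> serves all centres in \<open>cball 0 \<rho>\<close>, since
  \<open>L\<close> is global and one Lipschitz constant covers \<open>cball 0 (\<rho> + 1)\<close>.
  Lifting can thus proceed in steps of fixed size while it stays in
  \<open>cball 0 \<rho>\<close>.\<close>

lemma uniform_local_inverse:
  obtains r where "r > 0"
    "\<And>x a b. x \<in> cball 0 \<rho> \<Longrightarrow> a \<in> cball x r \<Longrightarrow> b \<in> cball x r \<Longrightarrow>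
      norm (a - b) \<le> 2 * L * norm (G a - G b)"
    "\<And>x p. x \<in> cball 0 \<rho> \<Longrightarrow> norm (p - G x) \<le> r / (2 * L) \<Longrightarrow>
      \<exists>z. G z = p \<and> norm (z - x) \<le> 2 * L * norm (p - G x)"
proof -
  obtain M0 where M0: "\<And>a b. a \<in> cball 0 (\<rho> + 1) \<Longrightarrow> b \<in> cball 0 (\<rho> + 1) \<Longrightarrow>
      norm (G1 a - G1 b) \<le> M0 * norm (a - b)"
    using locally_lipschitz[of "\<rho> + 1"] by blast
  define M where "M = max M0 1"
  have M: "M \<ge> 1" "M0 \<le> M" by (auto simp: M_def)
  \<comment> \<open>The bound \<open>1\<close> keeps \<open>cball x r\<close> inside
    \<open>cball 0 (\<rho> + 1)\<close>; the other bound yields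
    \<open>L * M * r \<le> 1/2\<close>.\<close>
  define r where "r = min 1 (1 / (2 * L * M))"
  have r: "r > 0" "r \<le> 1" using L_pos M by (auto simp: r_def)
  have "L * M * r \<le> L * M * (1 / (2 * L * M))"
    using L_pos M by (intro mult_left_mono) (auto simp: r_def)
  also have "\<dots> = 1 / 2" using L_pos M by simp
  finally have LMr: "L * M * r \<le> 1 / 2" .
  have lip: "norm (G1 z - G1 x) \<le> M * norm (z - x)" if "x \<in> cball 0 \<rho>" "z \<in> cball x r" for x z
  proof -
    have "norm z \<le> norm x + norm (z - x)"
      by (metis add.commute diff_add_cancel norm_triangle_ineq)
    then have "norm (G1 z - G1 x) \<le> M0 * norm (z - x)"
      using that r(2) by (intro M0) (auto simp: dist_norm norm_minus_commute)
    also have "\<dots> \<le> M * norm (z - x)" using M by (intro mult_right_mono) auto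
    finally show ?thesis .
  qed
  show thesis
  proof
    show "r > 0" by fact
    fix x :: 'a assume x: "x \<in> cball 0 \<rho>"
    obtain B where B: "blinfun_inverse_of (G1 x) B" "norm B \<le> L" using inverse by blast
    have M_nonneg: "M \<ge> 0" using M by simp
    note local_inverse = quantitative_local_inverse[OF der B L_pos lip[OF x] M_nonneg LMr r(1)]
    show bound: "norm (a - b) \<le> 2 * L * norm (G a - G b)" if "a \<in> cball x r" "b \<in> cball x r" for a b
      using local_inverse(1) that by blast
    show "\<exists>z. G z = p \<and> norm (z - x) \<le> 2 * L * norm (p - G x)"
      if p: "norm (p - G x) \<le> r / (2 * L)" for p
    proof -
      obtain z where "z \<in> cball x r" "G z = p" using local_inverse(2)[OF _ p] by blast
      then show ?thesis using bound[of z x] r by auto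
    qed
  qed
qed

text \<open>Each of the \<open>N\<close> equal steps along the segment from \<open>G x\<close> to
  \<open>p\<close> moves the preimage by at most \<open>2 * L\<close> times the step length. The
  total displacement therefore never exceeds \<open>2 * L * norm (p - G x)\<close>, so the lift
  stays in \<open>cball 0 \<rho>\<close> and \<open>step\<close> remains applicable.\<close>

lemma lift_segment:
  fixes x p :: 'a and N :: nat
  assumes N: "N > 0" "norm (p - G x) / N \<le> r / (2 * L)"
    and \<rho>: "norm x + 2 * L * norm (p - G x) \<le> \<rho>"
    and step: "\<And>x p. x \<in> cball 0 \<rho> \<Longrightarrow> norm (p - G x) \<le> r / (2 * L) \<Longrightarrow>
      \<exists>z. G z = p \<and> norm (z - x) \<le> 2 * L * norm (p - G x)"
  obtains h where "h 0 = x"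
    "\<And>j. j \<le> N \<Longrightarrow> G (h j) = G x + (real j / N) *\<^sub>R (p - G x)"
    "\<And>j. j \<le> N \<Longrightarrow> norm (h j - x) \<le> real j / N * (2 * L * norm (p - G x))"
    "\<And>j. j < N \<Longrightarrow> norm (h (Suc j) - h j) \<le> 2 * L * norm (p - G x) / N"
proof -
  define D where "D = 2 * L * norm (p - G x)"
  have D: "D \<ge> 0" using L_pos by (simp add: D_def)
  \<comment> \<open>\<open>P\<close> pins the start at \<open>j = 0\<close> and is void beyond
    \<open>N\<close>, so that dependent choice can run over all naturals.\<close>
  define P where "P j z \<longleftrightarrow> (j = 0 \<longrightarrow> z = x) \<and> (j \<le> N \<longrightarrow>
      G z = G x + (real j / N) *\<^sub>R (p - G x) \<and> norm (z - x) \<le> real j / N * D)" for j :: nat and z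
  define Q where "Q j z z' \<longleftrightarrow> (j < N \<longrightarrow> norm (z' - z) \<le> D / N)" for j :: nat and z z' :: 'a
  have "\<exists>h. \<forall>j. P j (h j) \<and> Q j (h j) (h (Suc j))"
  proof (rule dependent_nat_choice)
    show "\<exists>z. P 0 z" by (auto simp: P_def)
    fix z j assume z: "P j z"
    show "\<exists>z'. P (Suc j) z' \<and> Q j z z'"
    proof (cases "j < N")
      case False
      then show ?thesis by (auto simp: P_def Q_def)
    next
      case True
      have Gz: "G z = G x + (real j / N) *\<^sub>R (p - G x)" and zx: "norm (z - x) \<le> real j / N * D"
        using z True by (auto simp: P_def)
      define q where "q = G x + (real (Suc j) / N) *\<^sub>R (p - G x)"
      have "real j / N * D \<le> 1 * D" using True D by (intro mult_right_mono) auto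
      then have "norm z \<le> norm x + D"
        using zx norm_triangle_ineq[of x "z - x"] by simp
      then have z\<rho>: "z \<in> cball 0 \<rho>" using \<rho> by (simp add: D_def)
      have "q - G z = (1 / N) *\<^sub>R (p - G x)"
        by (simp add: q_def Gz add_divide_distrib scaleR_add_left)
      then have nq: "norm (q - G z) = norm (p - G x) / N" by simp
      then obtain z' where z': "G z' = q" "norm (z' - z) \<le> 2 * L * norm (q - G z)"
        using step[OF z\<rho>, of q] N(2) by auto
      then have z'z: "norm (z' - z) \<le> D / N" by (simp add: nq D_def)
      have "norm (z' - x) \<le> norm (z' - z) + norm (z - x)"
        using norm_triangle_ineq[of "z' - z" "z - x"] by simp
      also have "\<dots> \<le> real (Suc j) / N * D"
        using z'z zx by (simp add: add_divide_distrib distrib_right)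
      finally show ?thesis using z' z'z by (auto simp: P_def Q_def q_def)
    qed
  qed
  then obtain h where h: "\<And>j. P j (h j)" "\<And>j. Q j (h j) (h (Suc j))" by blast
  show thesis
  proof (rule that[of h])
    show "h 0 = x" using h(1)[of 0] by (simp add: P_def)
  qed (use h in \<open>auto simp: P_def Q_def D_def\<close>)
qed

text \<open>The a priori displacement bound fixes a ball containing the whole lift before
  \<open>r\<close> and \<open>N\<close> are chosen; the end of the lift is the solution.\<close>

lemma solution_near:
  obtains v where "G v = p" "norm (v - x) \<le> 2 * L * norm (p - G x)"
proof -
  obtain r where r: "r > 0" and step: "\<And>z q. z \<in> cball 0 (norm x + 2 * L * norm (p - G x)) \<Longrightarrow>
      norm (q - G z) \<le> r / (2 * L) \<Longrightarrow> \<exists>w. G w = q \<and> norm (w - z) \<le> 2 * L * norm (q - G z)"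
    using uniform_local_inverse[of "norm x + 2 * L * norm (p - G x)"] by metis
  obtain N :: nat where N: "N > norm (p - G x) / (r / (2 * L))"
    using reals_Archimedean2 by blast
  have rL: "r / (2 * L) > 0" using r L_pos by simp
  have N_pos: "N > 0"
    using order_le_less_trans[OF divide_nonneg_pos[OF norm_ge_zero rL] N] by simp
  then have "norm (p - G x) / N \<le> r / (2 * L)"
    using N r L_pos by (simp add: field_simps)
  from lift_segment[OF N_pos this order_refl step] obtain h where
    "G (h N) = G x + (real N / N) *\<^sub>R (p - G x)"
    "norm (h N - x) \<le> real N / N * (2 * L * norm (p - G x))"
    by (metis order_refl)
  then show thesis using N_pos by (intro that[of "h N"]) auto
qed

text \<open>
  Contract the image of the segment from \<open>v0\<close> to \<open>v1\<close> to the common value \<open>p\<close> and lift this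
  homotopy: the endpoints of the lifted paths depend locally constantly on the starting point,
  while the lifts starting at \<open>v0\<close> and \<open>v1\<close> do not move.
\<close>
lemma inj: "inj G"
proof (rule injI)
  fix v0 v1 assume eq: "G v0 = G v1"
  define p where "p = G v1"
  define \<gamma> where "\<gamma> s = v0 + s *\<^sub>R (v1 - v0)" for s :: real
  have contG: "continuous_on UNIV G"
    using der by (meson has_derivative_continuous continuous_at_imp_continuous_on)
  have cont\<gamma>: "continuous_on {0..1} \<gamma>" unfolding \<gamma>_def by (intro continuous_intros)
  have contG\<gamma>: "continuous_on {0..1} (\<lambda>s. G (\<gamma> s))"
    by (rule continuous_on_compose2[OF contG cont\<gamma>]) auto
  obtain K where K: "\<And>s. s \<in> {0..1} \<Longrightarrow> norm (p - G (\<gamma> s)) \<le> K"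
  proof -
    have "compact ((\<lambda>s. p - G (\<gamma> s)) ` {0..1})"
      by (intro compact_continuous_image continuous_intros contG\<gamma>) auto
    then have "bounded ((\<lambda>s. p - G (\<gamma> s)) ` {0..1})" by (rule compact_imp_bounded)
    then show thesis using that unfolding bounded_iff by blast
  qed
  have K_nonneg: "K \<ge> 0" using order_trans[OF norm_ge_zero K[of 0]] by simp
  \<comment> \<open>A common radius for all lifts: the first two terms bound
    \<open>\<gamma> s\<close>, the last one the displacement of its lift.\<close>
  define \<rho> where "\<rho> = norm v0 + norm (v1 - v0) + 2 * L * K"
  have \<gamma>_bound: "norm (\<gamma> s) + 2 * L * norm (p - G (\<gamma> s)) \<le> \<rho>" if s: "s \<in> {0..1}" for s
  proof -
    have "norm (\<gamma> s) \<le> norm v0 + norm (s *\<^sub>R (v1 - v0))"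
      unfolding \<gamma>_def by (rule norm_triangle_ineq)
    also have "norm (s *\<^sub>R (v1 - v0)) \<le> 1 * norm (v1 - v0)"
      unfolding norm_scaleR using s by (intro mult_right_mono) auto
    finally show ?thesis
      using K[OF s] L_pos unfolding \<rho>_def by (intro add_mono) auto
  qed
  obtain r where r: "r > 0"
    and bound: "\<And>x a b. x \<in> cball 0 \<rho> \<Longrightarrow> a \<in> cball x r \<Longrightarrow> b \<in> cball x r \<Longrightarrow>
      norm (a - b) \<le> 2 * L * norm (G a - G b)"
    and step: "\<And>x p. x \<in> cball 0 \<rho> \<Longrightarrow> norm (p - G x) \<le> r / (2 * L) \<Longrightarrow>
      \<exists>z. G z = p \<and> norm (z - x) \<le> 2 * L * norm (p - G x)"
    using uniform_local_inverse[of \<rho>] by metis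
  \<comment> \<open>With \<open>8 * L\<close> in place of \<open>2 * L\<close>, every step of a lift
    moves by at most \<open>r / 4\<close>. Two lifts that are \<open>r / 4\<close> apart are then
    still within \<open>3 * r / 4\<close> of each other after one more step.\<close>
  obtain N :: nat where N: "N > K / (r / (8 * L))" using reals_Archimedean2 by blast
  have N_pos: "N > 0"
    using order_le_less_trans[OF divide_nonneg_pos[OF K_nonneg, of "r / (8 * L)"] N] r L_pos by simp
  have KN: "K / N \<le> r / (8 * L)"
    using N N_pos r L_pos by (simp add: field_simps)
  have small: "norm (p - G (\<gamma> s)) / N \<le> r / (8 * L)" if "s \<in> {0..1}" for s
    using divide_right_mono[OF K[OF that], of "real N"] KN by simp
  \<comment> \<open>One lift is chosen for each \<open>s\<close>, with no continuity in
    \<open>s\<close> demanded. The last clause records that the lift of a degenerate segment stays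
    put.\<close>
  have "\<forall>s\<in>{0..1}. \<exists>h. h 0 = \<gamma> s \<and>
      (\<forall>j\<le>N. G (h j) = G (\<gamma> s) + (real j / N) *\<^sub>R (p - G (\<gamma> s)) \<and> h j \<in> cball 0 \<rho>) \<and>
      (\<forall>j<N. norm (h (Suc j) - h j) \<le> r / 4) \<and> (p = G (\<gamma> s) \<longrightarrow> h N = \<gamma> s)"
  proof
    fix s :: real assume s: "s \<in> {0..1}"
    have "norm (p - G (\<gamma> s)) / N \<le> r / (2 * L)"
    proof (rule order_trans[OF small[OF s]])
      show "r / (8 * L) \<le> r / (2 * L)" using r L_pos by (simp add: field_simps)
    qed
    from lift_segment[OF N_pos this \<gamma>_bound[OF s] step] obtain h where
      h: "h 0 = \<gamma> s" "\<And>j. j \<le> N \<Longrightarrow> G (h j) = G (\<gamma> s) + (real j / N) *\<^sub>R (p - G (\<gamma> s))"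
      "\<And>j. j \<le> N \<Longrightarrow> norm (h j - \<gamma> s) \<le> real j / N * (2 * L * norm (p - G (\<gamma> s)))"
      "\<And>j. j < N \<Longrightarrow> norm (h (Suc j) - h j) \<le> 2 * L * norm (p - G (\<gamma> s)) / N"
      by blast
    have "h j \<in> cball 0 \<rho>" if j: "j \<le> N" for j
    proof -
      have "norm (h j) \<le> norm (\<gamma> s) + norm (h j - \<gamma> s)"
        using norm_triangle_ineq[of "\<gamma> s" "h j - \<gamma> s"] by simp
      also have "norm (h j - \<gamma> s) \<le> 1 * (2 * L * norm (p - G (\<gamma> s)))"
        by (rule order_trans[OF h(3)[OF j]], rule mult_right_mono) (use j N_pos L_pos in auto)
      finally show ?thesis using \<gamma>_bound[OF s] by simp
    qed
    moreover have "2 * L * norm (p - G (\<gamma> s)) / N \<le> r / 4"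
      using mult_left_mono[OF small[OF s], of "2 * L"] L_pos by simp
    moreover have "h N = \<gamma> s" if "p = G (\<gamma> s)"
      using h(3)[of N] that by simp
    ultimately show "\<exists>h. h 0 = \<gamma> s \<and>
        (\<forall>j\<le>N. G (h j) = G (\<gamma> s) + (real j / N) *\<^sub>R (p - G (\<gamma> s)) \<and> h j \<in> cball 0 \<rho>) \<and>
        (\<forall>j<N. norm (h (Suc j) - h j) \<le> r / 4) \<and> (p = G (\<gamma> s) \<longrightarrow> h N = \<gamma> s)"
      using h(1,2) order_trans[OF h(4)] by blast
  qed
  from bchoice[OF this] obtain h where h:
    "\<And>s. s \<in> {0..1} \<Longrightarrow> h s 0 = \<gamma> s"
    "\<And>s j. s \<in> {0..1} \<Longrightarrow> j \<le> N \<Longrightarrow> G (h s j) = G (\<gamma> s) + (real j / N) *\<^sub>R (p - G (\<gamma> s))"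
    "\<And>s j. s \<in> {0..1} \<Longrightarrow> j \<le> N \<Longrightarrow> h s j \<in> cball 0 \<rho>"
    "\<And>s j. s \<in> {0..1} \<Longrightarrow> j < N \<Longrightarrow> norm (h s (Suc j) - h s j) \<le> r / 4"
    "\<And>s. s \<in> {0..1} \<Longrightarrow> p = G (\<gamma> s) \<Longrightarrow> h s N = \<gamma> s"
    by blast
  have diff: "G (h s j) - G (h t j) = (1 - real j / N) *\<^sub>R (G (\<gamma> s) - G (\<gamma> t))"
    if "s \<in> {0..1}" "t \<in> {0..1}" "j \<le> N" for s t j
    using that by (simp add: h(2) algebra_simps)
  \<comment> \<open>The distance may grow to \<open>3 * r / 4\<close> in a step, but this is within
    the local radius, where the inverse estimate brings it back to \<open>r / 4\<close>. Hence
    errors do not accumulate over \<open>j\<close>.\<close>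
  have close: "norm (h s j - h t j) \<le> r / 4"
    if st: "s \<in> {0..1}" "t \<in> {0..1}" and near: "norm (\<gamma> s - \<gamma> t) \<le> r / 4"
      "2 * L * norm (G (\<gamma> s) - G (\<gamma> t)) \<le> r / 4" and j: "j \<le> N" for s t j
    using j
  proof (induction j)
    case 0
    then show ?case using near st by (simp add: h(1))
  next
    case (Suc j)
    have "norm (h s (Suc j) - h t (Suc j)) \<le>
        norm (h s (Suc j) - h s j) + norm (h s j - h t j) + norm (h t (Suc j) - h t j)"
      using norm_triangle_ineq[of "h s (Suc j) - h s j" "h s j - h t j"]
        norm_triangle_ineq4[of "(h s (Suc j) - h s j) + (h s j - h t j)" "h t (Suc j) - h t j"]
      by simp
    also have "\<dots> \<le> r"
      using h(4)[OF st(1), of j] h(4)[OF st(2), of j] Suc r by simp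
    finally have "norm (h s (Suc j) - h t (Suc j)) \<le> 2 * L * norm (G (h s (Suc j)) - G (h t (Suc j)))"
      using r Suc.prems st
      by (intro bound[of "h s (Suc j)"] h(3)) (auto simp: dist_norm)
    also have "\<dots> \<le> 2 * L * (1 * norm (G (\<gamma> s) - G (\<gamma> t)))"
      unfolding diff[OF st Suc.prems] norm_scaleR
      using Suc.prems N_pos L_pos by (intro mult_left_mono mult_right_mono) (auto simp: field_simps)
    finally show ?case using near(2) by simp
  qed
  \<comment> \<open>For \<open>t\<close> near \<open>s\<close> the endpoints lie within
    \<open>r\<close> of each other and have the same image \<open>p\<close>, by \<open>diff\<close>
    with \<open>j = N\<close>; the local estimate makes them equal. Connectedness of the interval
    does the rest.\<close>
  have "h 0 N = h 1 N"
  proof (rule connected_local_const[where A = "{0..1::real}"])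
    show "\<forall>s\<in>{0..1}. eventually (\<lambda>t. h s N = h t N) (at s within {0..1})"
    proof
      fix s :: real assume s: "s \<in> {0..1}"
      have "eventually (\<lambda>t. dist (\<gamma> t) (\<gamma> s) < r / 4) (at s within {0..1})"
        using cont\<gamma> s r by (intro tendstoD) (auto simp: continuous_on_def)
      moreover have "eventually (\<lambda>t. dist (G (\<gamma> t)) (G (\<gamma> s)) < r / (8 * L)) (at s within {0..1})"
        using contG\<gamma> s r L_pos by (intro tendstoD) (auto simp: continuous_on_def)
      moreover have "eventually (\<lambda>t. t \<in> {0..1}) (at s within {0..1})"
        by (simp add: eventually_at_filter)
      ultimately show "eventually (\<lambda>t. h s N = h t N) (at s within {0..1})"
      proof eventually_elim
        case (elim t)
        have "norm (\<gamma> s - \<gamma> t) \<le> r / 4"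
          using elim(1) by (simp add: dist_norm norm_minus_commute)
        moreover have "2 * L * norm (G (\<gamma> s) - G (\<gamma> t)) \<le> r / 4"
          using elim(2) L_pos by (simp add: dist_norm norm_minus_commute field_simps)
        ultimately have "norm (h s N - h t N) \<le> r"
          using close[OF s elim(3), of N] r by simp
        then have "norm (h s N - h t N) \<le> 2 * L * norm (G (h s N) - G (h t N))"
          using r s by (intro bound[of "h s N"] h(3)) (auto simp: dist_norm)
        then show ?case using diff[OF s elim(3), of N] N_pos by simp
      qed
    qed
  qed auto
  then show "v0 = v1" using h(5)[of 0] h(5)[of 1] eq by (simp add: \<gamma>_def p_def)
qed

end

section \<open>The exponent bound and the regularized equation\<close>

text \<open>For \<open>k > 1\<close> the power \<open>\<epsilon> powr (1 - k)\<close> blows up at 0.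
  The second entry of the minimum defining \<open>e\<close> is the point where
  \<open>c * e powr (1 - k)\<close> equals 1.\<close>

lemma exponent_le_one:
  fixes c k e0 :: real
  assumes c: "c > 0" and e0: "e0 > 0"
    and small: "\<And>\<epsilon>. \<epsilon> \<in> {0<..<e0} \<Longrightarrow> c * \<epsilon> powr (1 - k) < 1"
  shows "k \<le> 1"
proof (rule ccontr)
  assume k: "\<not> k \<le> 1"
  define e where "e = min (e0 / 2) (c powr (1 / (k - 1)))"
  have e: "e > 0" "e < e0" using c e0 by (auto simp: e_def)
  have "e powr (k - 1) \<le> (c powr (1 / (k - 1))) powr (k - 1)"
    using k e by (intro powr_mono2) (auto simp: e_def)
  also have "\<dots> = c" using k c by (simp add: powr_powr)
  finally have "e powr (k - 1) \<le> c" .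
  moreover have "e powr (k - 1) * e powr (1 - k) = 1"
    using e by (simp flip: powr_add)
  ultimately have "c * e powr (1 - k) \<ge> 1"
    using mult_right_mono[of "e powr (k - 1)" c "e powr (1 - k)"] by simp
  then show False using small[of e] e by simp
qed

theorem theorem2:
  fixes F :: "'a::banach \<Rightarrow> 'a"
    and F1 :: "'a \<Rightarrow> 'a \<Rightarrow>\<^sub>L 'a"
    and F2 :: "'a \<Rightarrow> 'a \<Rightarrow>\<^sub>L 'a \<Rightarrow>\<^sub>L 'a"
    and F3 :: "'a \<Rightarrow> 'a \<Rightarrow>\<^sub>L 'a \<Rightarrow>\<^sub>L 'a \<Rightarrow>\<^sub>L 'a"
    and u0 y \<psi> :: 'a
    and M1 M2 M3 :: "real \<Rightarrow> real"
    and c0 k \<epsilon>0 R :: real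
  assumes F_derivs: "frechet_derivs3 F F1 F2 F3"
    and M_pos: "\<And>r. r > 0 \<Longrightarrow> M1 r > 0 \<and> M2 r > 0 \<and> M3 r > 0"
    and M1_bound: "\<And>r u. r > 0 \<Longrightarrow> u \<in> cball u0 r \<Longrightarrow> norm (F1 u) \<le> M1 r"
    and M2_bound: "\<And>r u. r > 0 \<Longrightarrow> u \<in> cball u0 r \<Longrightarrow> norm (F2 u) \<le> M2 r"
    and M3_bound: "\<And>r u. r > 0 \<Longrightarrow> u \<in> cball u0 r \<Longrightarrow> norm (F3 u) \<le> M3 r"
    and c0_pos: "c0 > 0" and k_pos: "k > 0" and \<epsilon>0_pos: "\<epsilon>0 > 0"
    and invertible: "\<And>u \<epsilon>. \<epsilon> \<in> {0<..<\<epsilon>0} \<Longrightarrow> boundedly_invertible (F1 u + \<epsilon> *\<^sub>R id_blinfun)"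
    and inverse_bound: "\<And>u \<epsilon>. \<epsilon> \<in> {0<..<\<epsilon>0} \<Longrightarrow>
          norm (blinfun_inv (F1 u + \<epsilon> *\<^sub>R id_blinfun)) \<le> c0 * \<epsilon> powr (- k)"
    and y_solves: "F y = 0"
    and source_condition: "y = blinfun_apply (F1 y) \<psi>"
    and R_pos: "R > 0" and y_interior: "y \<in> interior (cball u0 R)"
    and smallness: "\<And>\<epsilon>. \<epsilon> \<in> {0<..<\<epsilon>0} \<Longrightarrow> 2 * c0 * M2 R * norm \<psi> * \<epsilon> powr (1 - k) < 1"
  shows "\<exists>C > 0. \<exists>\<epsilon>1 \<in> {0<..\<epsilon>0}. \<forall>\<epsilon> \<in> {0<..<\<epsilon>1}.
           \<exists>!v. F v + \<epsilon> *\<^sub>R v = 0 \<and> norm (v - y) \<le> C * \<epsilon> powr k"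
proof -
  have F_der: "(F has_derivative blinfun_apply (F1 u)) (at u)"
    and F1_der: "(F1 has_derivative blinfun_apply (F2 u)) (at u)" for u
    using F_derivs by (auto simp: frechet_derivs3_def)
  have lip: "\<exists>M. \<forall>a \<in> cball 0 \<rho>. \<forall>b \<in> cball 0 \<rho>. norm (F1 a - F1 b) \<le> M * norm (a - b)" for \<rho>
  proof -
    \<comment> \<open>This radius is positive and makes \<open>cball u0 r\<close> contain
      \<open>cball 0 \<rho>\<close>, which transfers the bound on \<open>F2\<close>.\<close>
    define r where "r = \<bar>\<rho>\<bar> + norm u0 + 1"
    have "r > 0" by (simp add: r_def add_nonneg_pos)
    moreover have "a \<in> cball u0 r" if "a \<in> cball 0 \<rho>" for a
      using that norm_triangle_ineq4[of u0 a] by (simp add: r_def dist_norm)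
    ultimately have bound: "norm (F2 a) \<le> M2 r" if "a \<in> cball 0 \<rho>" for a
      using M2_bound that by blast
    have "norm (F1 a - F1 b) \<le> M2 r * norm (a - b)" if "a \<in> cball 0 \<rho>" "b \<in> cball 0 \<rho>" for a b
      by (rule differentiable_bound[OF convex_cball has_derivative_at_withinI[OF F1_der] _ that])
        (use bound in \<open>simp add: norm_blinfun.rep_eq\<close>)
    then show ?thesis by blast
  qed
  obtain M0 where M0: "\<And>a b. a \<in> cball 0 (norm y + norm \<psi>) \<Longrightarrow> b \<in> cball 0 (norm y + norm \<psi>) \<Longrightarrow>
      norm (F1 a - F1 b) \<le> M0 * norm (a - b)"
    using lip by blast
  define M where "M = \<bar>M0\<bar>"
  have k_le_1: "k \<le> 1" if "\<psi> \<noteq> 0"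
    using that c0_pos M_pos[OF R_pos] \<epsilon>0_pos
    by (intro exponent_le_one[OF _ \<epsilon>0_pos smallness]) auto
  \<comment> \<open>\<open>D\<close> will bound \<open>norm (G w) / \<epsilon>\<^sup>2\<close>: the
    quadratic term is the Taylor remainder of \<open>F\<close> at \<open>y\<close>, the linear one
    comes from \<open>\<epsilon> *\<^sub>R w\<close>. In \<open>C\<close>,
    \<open>norm \<psi>\<close> pays for \<open>w - y\<close>, \<open>2 * c0 * D\<close> for
    \<open>v - w\<close>, and \<open>1\<close> ensures positivity.\<close>
  define D where "D = norm \<psi> + M * norm \<psi> ^ 2"
  have D: "D \<ge> 0" by (simp add: D_def M_def)
  define C where "C = norm \<psi> + 2 * c0 * D + 1"
  have C: "C > 0" unfolding C_def using c0_pos D by (intro add_nonneg_pos add_nonneg_nonneg) auto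
  have "\<exists>!v. F v + \<epsilon> *\<^sub>R v = 0 \<and> norm (v - y) \<le> C * \<epsilon> powr k" if \<epsilon>: "\<epsilon> \<in> {0<..<min 1 \<epsilon>0}" for \<epsilon>
  proof -
    have \<epsilon>': "0 < \<epsilon>" "\<epsilon> < 1" "\<epsilon> \<in> {0<..<\<epsilon>0}" using \<epsilon> by auto
    define G where "G v = F v + \<epsilon> *\<^sub>R v" for v
    interpret hadamard G "\<lambda>u. F1 u + \<epsilon> *\<^sub>R id_blinfun" "c0 * \<epsilon> powr (- k)"
    proof
      show "(G has_derivative blinfun_apply (F1 u + \<epsilon> *\<^sub>R id_blinfun)) (at u)" for u
        unfolding G_def
        using has_derivative_add[OF F_der bounded_linear_imp_has_derivative[OF bounded_linear_scaleR_right]]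
        by (simp add: blinfun.add_left blinfun.scaleR_left fun_eq_iff plus_blinfun.rep_eq
            scaleR_blinfun.rep_eq id_blinfun.rep_eq)
      show "c0 * \<epsilon> powr (- k) > 0" using c0_pos \<epsilon>' by simp
      show "\<exists>B. blinfun_inverse_of (F1 u + \<epsilon> *\<^sub>R id_blinfun) B \<and> norm B \<le> c0 * \<epsilon> powr (- k)" for u
        using invertible[OF \<epsilon>'(3), of u] inverse_bound[OF \<epsilon>'(3), of u] blinfun_inv_eq
        unfolding boundedly_invertible_def by metis
      show "\<exists>M. \<forall>a\<in>cball 0 \<rho>. \<forall>b\<in>cball 0 \<rho>.
          norm (F1 a + \<epsilon> *\<^sub>R id_blinfun - (F1 b + \<epsilon> *\<^sub>R id_blinfun)) \<le> M * norm (a - b)" for \<rho>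
        using lip[of \<rho>] by simp
    qed
    \<comment> \<open>The linear term of \<open>F\<close> at \<open>w\<close> is \<open>- \<epsilon>
      *\<^sub>R F1 y \<psi> = - \<epsilon> *\<^sub>R y\<close>, which cancels the first-order
      residual \<open>\<epsilon> *\<^sub>R y\<close> of \<open>G\<close> at
      \<open>y\<close>.\<close>
    define w where "w = y - \<epsilon> *\<^sub>R \<psi>"
    have "norm (F w - F y - blinfun_apply (F1 y) (w - y)) \<le> norm (w - y) * (M * (\<epsilon> * norm \<psi>))"
    proof (rule differentiable_bound_linearization[where S = "cball y (\<epsilon> * norm \<psi>)"
          and f' = "\<lambda>u. blinfun_apply (F1 u)"])
      show "y + t *\<^sub>R (w - y) \<in> cball y (\<epsilon> * norm \<psi>)" if t: "t \<in> {0..1}" for t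
        using mult_right_mono[of t 1 "\<epsilon> * norm \<psi>"] t \<epsilon>' by (simp add: dist_norm w_def)
      show "y \<in> cball y (\<epsilon> * norm \<psi>)" using \<epsilon>' by simp
      show "(F has_derivative blinfun_apply (F1 u)) (at u within cball y (\<epsilon> * norm \<psi>))" for u
        by (rule has_derivative_at_withinI[OF F_der])
      fix z assume "z \<in> cball y (\<epsilon> * norm \<psi>)"
      then have zy: "norm (z - y) \<le> \<epsilon> * norm \<psi>" by (simp add: dist_norm norm_minus_commute)
      also have "\<dots> \<le> 1 * norm \<psi>" using \<epsilon>' by (intro mult_right_mono) auto
      finally have "norm z \<le> norm y + norm \<psi>" using norm_triangle_ineq[of y "z - y"] by simp
      then have "norm (F1 z - F1 y) \<le> M0 * norm (z - y)" by (intro M0) auto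
      also have "\<dots> \<le> M * (\<epsilon> * norm \<psi>)" using zy by (intro mult_mono) (auto simp: M_def)
      finally show "onorm (blinfun_apply (F1 z) - blinfun_apply (F1 y)) \<le> M * (\<epsilon> * norm \<psi>)"
        by (simp add: norm_blinfun.rep_eq minus_blinfun.rep_eq fun_diff_def)
    qed
    also have "norm (w - y) = \<epsilon> * norm \<psi>" using \<epsilon>' by (simp add: w_def)
    also have "F w - F y - blinfun_apply (F1 y) (w - y) = F w + \<epsilon> *\<^sub>R y"
      using source_condition by (simp add: y_solves w_def blinfun.minus_right blinfun.scaleR_right)
    finally have "norm (F w + \<epsilon> *\<^sub>R y) \<le> \<epsilon>\<^sup>2 * (M * norm \<psi> ^ 2)"
      by (simp add: power2_eq_square mult_ac)
    moreover have "G w = (F w + \<epsilon> *\<^sub>R y) - \<epsilon>\<^sup>2 *\<^sub>R \<psi>"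
      by (simp add: G_def w_def power2_eq_square algebra_simps)
    ultimately have "norm (G w) \<le> \<epsilon>\<^sup>2 * (M * norm \<psi> ^ 2) + \<epsilon>\<^sup>2 * norm \<psi>"
      using norm_triangle_ineq4[of "F w + \<epsilon> *\<^sub>R y" "\<epsilon>\<^sup>2 *\<^sub>R \<psi>"] by simp
    then have Gw: "norm (0 - G w) \<le> \<epsilon>\<^sup>2 * D" by (simp add: D_def algebra_simps)
    obtain v where v: "G v = 0" "norm (v - w) \<le> 2 * (c0 * \<epsilon> powr (- k)) * norm (0 - G w)"
      by (rule solution_near)
    have "norm (v - w) \<le> 2 * (c0 * \<epsilon> powr (- k)) * (\<epsilon>\<^sup>2 * D)"
      using c0_pos by (intro order_trans[OF v(2)] mult_left_mono Gw) auto
    also have "\<dots> = 2 * c0 * D * \<epsilon> powr (2 - k)"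
      using \<epsilon>' by (simp add: powr_diff powr_minus powr_numeral field_simps)
    finally have vw: "norm (v - w) \<le> 2 * c0 * D * \<epsilon> powr (2 - k)" .
    have "norm (v - y) \<le> norm (v - w) + norm (w - y)"
      using norm_triangle_ineq[of "v - w" "w - y"] by simp
    then have vy: "norm (v - y) \<le> 2 * c0 * D * \<epsilon> powr (2 - k) + \<epsilon> * norm \<psi>"
      using vw \<open>norm (w - y) = \<epsilon> * norm \<psi>\<close> by simp
    \<comment> \<open>If \<open>\<psi> = 0\<close>, then \<open>D = 0\<close> and
      \<open>v = y\<close>, whatever \<open>k\<close> is. Otherwise \<open>k \<le> 1\<close>, so
      both exponents \<open>2 - k\<close> and \<open>1\<close> are at least \<open>k\<close>, and
      \<open>\<epsilon> < 1\<close> turns this into the bound.\<close>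
    have "norm (v - y) \<le> C * \<epsilon> powr k"
    proof (cases "\<psi> = 0")
      case True
      then show ?thesis using vy C by (simp add: D_def)
    next
      case False
      have "\<epsilon> powr (2 - k) \<le> \<epsilon> powr k" "\<epsilon> \<le> \<epsilon> powr k"
        using k_le_1[OF False] \<epsilon>' powr_mono'[of k 1 \<epsilon>] by (auto intro!: powr_mono')
      then have "2 * c0 * D * \<epsilon> powr (2 - k) + norm \<psi> * \<epsilon> \<le> 2 * c0 * D * \<epsilon> powr k + norm \<psi> * \<epsilon> powr k"
        using c0_pos D \<epsilon>' by (intro add_mono mult_left_mono) auto
      also have "\<dots> \<le> C * \<epsilon> powr k" by (simp add: C_def algebra_simps)
      finally show ?thesis using vy by (simp add: mult.commute)
    qed
    \<comment> \<open>Uniqueness comes from injectivity of \<open>G\<close> on the whole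
      space.\<close>
    then show ?thesis using v(1) injD[OF inj] unfolding G_def by (metis (no_types, lifting))
  qed
  moreover have "min 1 \<epsilon>0 \<in> {0<..\<epsilon>0}" using \<epsilon>0_pos by simp
  ultimately show ?thesis using C by blast
qed

end
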